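(* Let $p\geq 1$ be an integer, $q\in(0,1)$, $\mu>-1$ and $-1\leq B<A\leq 1$. Let $f\in\mathcal{S}_p^{\ast}(q,\mu,A,B)$ be of the form $f(z)=z^p+\sum_{n=1}^{\infty}a_{n+p}z^{n+p}$. Then $$|a_{p+1}|\leq\frac{\psi_1(A-B)}{\Lambda_{1+p}},$$ and for every integer $n\geq2$, $$|a_{n+p}|\leq\frac{(A-B)\psi_n}{\Lambda_{n+p}}\prod_{t=1}^{n-1}\left(1+\frac{[p,q](A-B)}{[p+t,q]-[p,q]}\right),$$ where $\psi_n=\dfrac{[p,q]}{[n+p,q]-[p,q]}$ for $n\ge1$.
   Context: Let $\mathbb{D}=\{z\in\mathbb{C}:|z|<1\}$. For an integer $p\ge 1$, $\mathfrak{A}_p$ is the set of functions analytic in $\mathbb{D}$ of the form $f(z)=z^p+\sum_{n=1}^\infty a_{n+p}z^{n+p}$. For $q\in(0,1)$ and real $x$, $[x,q]=\frac{1-q^x}{1-q}$; for integers $n\ge1$, $[n,q]!=[1,q][2,q]\cdots[n,q]$ and $[0,q]!=1$; for $x>0$, $[x,q]_0=1$ and $[x,q]_n=[x,q][x+1,q]\cdots[x+n-1,q]$ for $n\ge 1$. For $\mu>-1$ put $\Lambda_{n+p}=\frac{[\mu+1,q]_{n+p}}{[n+p,q]!}$. The $q$-derivative is $\partial_q f(z)=\frac{f(z)-f(qz)}{z(1-q)}$ for $z\ne0$, so that it acts on power series termwise by $\partial_q z^m=[m,q]z^{m-1}$. The operator $\mathcal{L}_q^{\mu+p-1}:\mathfrak{A}_p\to\mathfrak{A}_p$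 is $\mathcal{L}_q^{\mu+p-1}f(z)=z^p+\sum_{n=1}^\infty \Lambda_{n+p}a_{n+p}z^{n+p}$. For $g,h$ analytic in $\mathbb{D}$, $g\prec h$ (subordination) means there is an analytic $w$ on $\mathbb{D}$ with $w(0)=0$, $|w(z)|<1$ and $g(z)=h(w(z))$ for all $z\in\mathbb{D}$. For $q\in(0,1)$, $\mu>-1$ and $-1\le B<A\le1$, the class $\mathcal{S}_p^{\ast}(q,\mu,A,B)$ consists of all $f\in\mathfrak{A}_p$ such that $$\frac{z\,\partial_q\mathcal{L}_q^{\mu+p-1}f(z)}{[p,q]\,\mathcal{L}_q^{\mu+p-1}f(z)}\prec\frac{1+Az}{1+Bz},$$ where the quotient on the left is understood to take the value $1$ at $z=0$. *)

theory Defs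
  imports "HOL-Complex_Analysis.Complex_Analysis"
begin

definition q_num :: "real \<Rightarrow> real \<Rightarrow> real" where
  "q_num q x = (1 - q powr x) / (1 - q)"

definition q_fact :: "real \<Rightarrow> nat \<Rightarrow> real" where
  "q_fact q n = (\<Prod>k=1..n. q_num q (real k))"

definition q_shifted_fact :: "real \<Rightarrow> real \<Rightarrow> nat \<Rightarrow> real" where
  "q_shifted_fact q x n = (\<Prod>k<n. q_num q (x + real k))"

text \<open>The weight is indexed by the full exponent, i.e. by \<open>m = n + p\<close>.\<close>

definition Lambda :: "real \<Rightarrow> real \<Rightarrow> nat \<Rightarrow> real" where
  "Lambda q \<mu> m = q_shifted_fact q (\<mu> + 1) m / q_fact q m"

definition psi :: "nat \<Rightarrow> real \<Rightarrow> nat \<Rightarrow> real" where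
  "psi p q n = q_num q (real p) / (q_num q (real (n + p)) - q_num q (real p))"

text \<open>Functions on the unit disc are represented by total functions on the complex
  plane; their values outside \<open>ball 0 1\<close> play no role. Series over \<open>n \<ge> 1\<close> are written
  with \<open>Suc n\<close>, and the values \<open>a m\<close> with \<open>m \<le> p\<close> are irrelevant.\<close>

definition has_expansion :: "nat \<Rightarrow> (nat \<Rightarrow> complex) \<Rightarrow> (complex \<Rightarrow> complex) \<Rightarrow> bool" where
  "has_expansion p a f \<longleftrightarrow>
     (\<forall>z\<in>ball 0 1. (\<lambda>n. a (Suc n + p) * z ^ (Suc n + p)) sums (f z - z ^ p))"

definition class_A :: "nat \<Rightarrow> (complex \<Rightarrow> complex) set" where
  "class_A p = {f. f analytic_on ball 0 1 \<and> (\<exists>a. has_expansion p a f)}"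

text \<open>At the origin the termwise rule leaves only the coefficient of \<open>z\<close>, which is the
  ordinary derivative.\<close>

definition q_deriv :: "real \<Rightarrow> (complex \<Rightarrow> complex) \<Rightarrow> complex \<Rightarrow> complex" where
  "q_deriv q f z =
     (if z = 0 then deriv f 0
      else (f z - f (of_real q * z)) / (z * (1 - of_real q)))"

definition taylor_coeff :: "(complex \<Rightarrow> complex) \<Rightarrow> nat \<Rightarrow> complex" where
  "taylor_coeff f m = (deriv ^^ m) f 0 / fact m"

definition L_op :: "real \<Rightarrow> real \<Rightarrow> nat \<Rightarrow> (complex \<Rightarrow> complex) \<Rightarrow> complex \<Rightarrow> complex" where
  "L_op q \<mu> p f z =
     z ^ p + (\<Sum>n. of_real (Lambda q \<mu> (Suc n + p)) * taylor_coeff f (Suc n + p) * z ^ (Suc n + p))"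

definition subordinate :: "(complex \<Rightarrow> complex) \<Rightarrow> (complex \<Rightarrow> complex) \<Rightarrow> bool" where
  "subordinate g h \<longleftrightarrow>
     g analytic_on ball 0 1 \<and> h analytic_on ball 0 1 \<and>
     (\<exists>w. w analytic_on ball 0 1 \<and> w 0 = 0 \<and>
          (\<forall>z\<in>ball 0 1. norm (w z) < 1 \<and> g z = h (w z)))"

text \<open>A zero of the denominator at some \<open>z \<noteq> 0\<close> would give the quotient below the value
  \<open>0\<close>. This never satisfies the subordination in \<open>class_S\<close>, since
  \<open>(1 + A w) / (1 + B w)\<close> does not vanish for \<open>|w| < 1\<close> when \<open>|A|, |B| \<le> 1\<close>; so membership
  in \<open>class_S\<close> forces the denominator to be nonzero on the punctured disc.\<close>

definition L_quotient :: "real \<Rightarrow> real \<Rightarrow> nat \<Rightarrow> (complex \<Rightarrow> complex) \<Rightarrow> complex \<Rightarrow> complex" where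
  "L_quotient q \<mu> p f z =
     (if z = 0 then 1
      else z * q_deriv q (L_op q \<mu> p f) z / (of_real (q_num q (real p)) * L_op q \<mu> p f z))"

definition class_S :: "nat \<Rightarrow> real \<Rightarrow> real \<Rightarrow> real \<Rightarrow> real \<Rightarrow> (complex \<Rightarrow> complex) set" where
  "class_S p q \<mu> A B =
     {f \<in> class_A p.
        subordinate (L_quotient q \<mu> p f) (\<lambda>z. (1 + of_real A * z) / (1 + of_real B * z))}"

end

theory Submission
  imports Defs
begin

text \<open>
  Write \<open>b\<^sub>k = \<Lambda>\<^bsub>k+p\<^esub> a\<^bsub>k+p\<^esub>\<close>, with \<open>b\<^sub>0 = 1\<close>, for the coefficients of the transformed
  function \<open>F\<close>, and \<open>P = 1 + c\<^sub>1 z + c\<^sub>2 z\<^sup>2 + \<dots>\<close> for the quotient that is subordinate to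
  \<open>(1 + A z) / (1 + B z)\<close>. Since the q-derivative multiplies \<open>z\<^sup>m\<close> by \<open>[m,q] / z\<close>, comparing
  coefficients in \<open>z \<partial>\<^sub>q F = [p,q] P F\<close> gives
  \<open>([n+p,q] - [p,q]) b\<^sub>n = [p,q] (c\<^sub>n b\<^sub>0 + \<dots> + c\<^sub>1 b\<^bsub>n-1\<^esub>)\<close>
  (\<open>q_logarithmic_derivative_recursion\<close>).

  The analytic ingredient is \<open>\<bar>c\<^sub>n\<bar> \<le> A - B\<close> for all \<open>n \<ge> 1\<close>, an instance of Rogosinski's
  theorem on functions subordinate to a convex one
  (\<open>subordinate_moebius_norm_coeff_le\<close>). The image of the disc under
  \<open>(1 + A z) / (1 + B z)\<close> is a disc or a half-plane, hence convex, so the average of \<open>P\<close> over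
  the rotations by \<open>n\<close>-th roots of unity still takes its values there. The average
  begins with \<open>1 + c\<^sub>n z\<^sup>n\<close>; pulling it back by the Moebius map gives a function bounded
  by 1 whose \<open>n\<close>-th coefficient is \<open>c\<^sub>n / (A - B)\<close>, and Cauchy's inequality applies.

  Consequently \<open>\<bar>b\<^sub>n\<bar> \<le> (A - B) \<psi>\<^sub>n (\<bar>b\<^sub>0\<bar> + \<dots> + \<bar>b\<^bsub>n-1\<^esub>\<bar>)\<close>, and each partial sum is at most
  \<open>1 + (A - B) \<psi>\<^sub>t\<close> times the preceding one (\<open>sum_le_prod_of_recursive_bound\<close>). This
  yields the product in the estimate; the case \<open>n = 1\<close> has the empty product.
\<close>

section \<open>Auxiliary facts\<close>

lemma eventually_nhds_0_of_ball:
  fixes P :: "'a :: real_normed_vector \<Rightarrow> bool"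
  assumes "r > 0" and "\<And>z. norm z < r \<Longrightarrow> P z"
  shows "\<forall>\<^sub>F z in nhds 0. P z"
  using eventually_nhds_in_open[OF open_ball, of 0 0 r] assms
  by (auto elim: eventually_mono)

lemma one_plus_mult_nonzero:
  fixes u :: complex and C :: real
  assumes C: "\<bar>C\<bar> \<le> 1" and u: "norm u < 1"
  shows "1 + of_real C * u \<noteq> 0"
proof -
  have "\<bar>C\<bar> * norm u \<le> norm u"
    using C by (intro mult_left_le_one_le) auto
  then have "norm (of_real C * u) < 1"
    using u by (simp add: norm_mult)
  then show ?thesis
    by (metis add_eq_0_iff norm_minus_cancel norm_one less_irrefl)
qed

section \<open>Coefficients of functions with values in a disc or a half-plane\<close>

text \<open>Cauchy's inequality on the circles of radius \<open>r < 1\<close>, followed by \<open>r \<longlonglongrightarrow> 1\<close>, since nothing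
  is known on the unit circle itself.\<close>

lemma bounded_imp_norm_coeff_le:
  fixes f :: "complex \<Rightarrow> complex"
  assumes hol: "f holomorphic_on ball 0 1"
    and bound: "\<And>z. norm z < 1 \<Longrightarrow> norm (f z) \<le> C"
    and F: "f has_fps_expansion F"
  shows "norm (fps_nth F n) \<le> C"
proof -
  have est: "norm (fps_nth F n) * r ^ n \<le> C" if r: "0 < r" "r < 1" for r
  proof -
    have "norm ((deriv ^^ n) f 0) \<le> fact n * C / r ^ n"
    proof (rule Cauchy_inequality)
      show "f holomorphic_on ball 0 r"
        by (rule holomorphic_on_subset[OF hol]) (use r in auto)
      have "f holomorphic_on cball 0 r"
        by (rule holomorphic_on_subset[OF hol]) (use r in auto)
      then show "continuous_on (cball 0 r) f"
        by (rule holomorphic_on_imp_continuous_on)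
    qed (use r bound in auto)
    then show ?thesis
      using r by (simp add: fps_nth_fps_expansion[OF F] norm_divide field_simps)
  qed
  have lim: "((\<lambda>r. norm (fps_nth F n) * r ^ n) \<longlongrightarrow> norm (fps_nth F n) * 1 ^ n) (at_left (1::real))"
    by (intro tendsto_intros)
  have "\<forall>\<^sub>F r in at_left (1::real). norm (fps_nth F n) * r ^ n \<le> C"
    using eventually_at_left_real[of 0 "1::real"] est by (auto elim: eventually_mono)
  then show ?thesis
    using tendsto_upperbound[OF lim] by simp
qed

text \<open>Squaring turns the condition into \<open>\<phi> y < 0\<close> for a real quadratic \<open>\<phi>\<close> whose leading
  coefficient \<open>1 - b\<^sup>2\<close> is nonnegative, so \<open>\<phi>\<close> is convex. For \<open>\<bar>b\<bar> < 1\<close> and \<open>a \<noteq> 0\<close> the set is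
  a disc, for \<open>\<bar>b\<bar> = 1\<close> and \<open>a \<noteq> 0\<close> a half-plane; the argument treats both at once.\<close>

lemma convex_norm_less_norm_affine:
  fixes a b :: real
  assumes "\<bar>b\<bar> \<le> 1"
  shows "convex {y :: complex. norm y < norm (of_real a - of_real b * y)}"
proof -
  define \<phi> :: "complex \<Rightarrow> real"
    where "\<phi> y = (1 - b\<^sup>2) * (norm y)\<^sup>2 + 2 * a * b * Re y - a\<^sup>2" for y
  have \<phi>: "norm y < norm (of_real a - of_real b * y) \<longleftrightarrow> \<phi> y < 0" for y :: complex
  proof -
    have "norm y < norm (of_real a - of_real b * y)
        \<longleftrightarrow> (norm y)\<^sup>2 < (norm (of_real a - of_real b * y))\<^sup>2"
      using abs_le_square_iff[of "norm (of_real a - of_real b * y)" "norm y"] by (simp add: not_le[symmetric])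
    also have "(norm (of_real a - of_real b * y))\<^sup>2 = (norm y)\<^sup>2 - \<phi> y"
      by (simp add: \<phi>_def cmod_power2) algebra
    finally show ?thesis by simp
  qed
  have b2: "b\<^sup>2 \<le> 1"
    using assms by (simp add: abs_square_le_1)
  show ?thesis
  proof (rule convexI)
    fix x y :: complex and u v :: real
    assume xy: "x \<in> {y. norm y < norm (of_real a - of_real b * y)}"
      "y \<in> {y. norm y < norm (of_real a - of_real b * y)}"
      and uv: "0 \<le> u" "0 \<le> v" "u + v = 1"
    have v: "v = 1 - u" using uv by simp
    \<comment> \<open>The defect in the convexity inequality of \<open>\<phi>\<close> comes from its quadratic term only.\<close>
    have "\<phi> (u *\<^sub>R x + v *\<^sub>R y)
        = u * \<phi> x + v * \<phi> y - (1 - b\<^sup>2) * (u * v) * (norm (x - y))\<^sup>2"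
      unfolding \<phi>_def cmod_power2 v by (simp add: power2_eq_square) (simp add: algebra_simps)
    moreover have "(1 - b\<^sup>2) * (u * v) * (norm (x - y))\<^sup>2 \<ge> 0"
      using b2 uv by simp
    moreover have "u * \<phi> x + v * \<phi> y < 0"
      using convex_bound_lt[of "\<phi> x" 0 "\<phi> y" u v] xy uv \<phi> by simp
    ultimately show "u *\<^sub>R x + v *\<^sub>R y \<in> {y. norm y < norm (of_real a - of_real b * y)}"
      using \<phi> by simp
  qed
qed

text \<open>Rotation by \<open>\<epsilon>\<^sup>j\<close> multiplies the \<open>m\<close>-th coefficient by \<open>\<epsilon>\<^bsup>jm\<^esup>\<close>, and the average of these
  factors over \<open>j < n\<close> is a geometric sum that vanishes unless \<open>\<epsilon>\<^sup>m = 1\<close>.\<close>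

lemma rotation_average_expansion:
  fixes g :: "complex \<Rightarrow> complex"
  assumes G: "g has_fps_expansion G" and n: "n \<ge> 1"
  defines "\<epsilon> \<equiv> cis (2 * pi / real n)"
  obtains H where "(\<lambda>z. \<Sum>j<n. (1 / real n) *\<^sub>R g (\<epsilon> ^ j * z)) has_fps_expansion H"
    and "\<And>m. fps_nth H m = (if n dvd m then fps_nth G m else 0)"
proof
  let ?H = "\<Sum>j<n. fps_const (of_real (1 / real n)) * (G oo (fps_const (\<epsilon> ^ j) * fps_X))"
  have lin: "(\<lambda>z. c * z) has_fps_expansion fps_const c * fps_X" for c :: complex
    by (intro fps_expansion_intros)
  have "(g \<circ> (\<lambda>z. \<epsilon> ^ j * z)) has_fps_expansion (G oo (fps_const (\<epsilon> ^ j) * fps_X))" for j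
    by (rule has_fps_expansion_compose[OF G lin]) simp
  then show "(\<lambda>z. \<Sum>j<n. (1 / real n) *\<^sub>R g (\<epsilon> ^ j * z)) has_fps_expansion ?H"
    unfolding scaleR_conv_of_real
    by (intro has_fps_expansion_sum has_fps_expansion_cmult_left) (simp add: o_def)
  fix m
  have pow: "\<epsilon> ^ m = 1 \<longleftrightarrow> n dvd m"
  proof -
    have "\<epsilon> ^ m = exp (2 * of_real pi * \<i> * of_nat m / of_nat n)"
      unfolding \<epsilon>_def by (simp add: cis_conv_exp exp_of_nat_mult[symmetric] mult_ac)
    then show ?thesis
      using complex_root_unity_eq_1[OF n, of m] by simp
  qed
  have "fps_nth ?H m = fps_nth G m * ((\<Sum>j<n. (\<epsilon> ^ m) ^ j) / of_nat n)"
    unfolding fps_compose_linear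
    by (simp add: fps_sum_nth sum_distrib_left sum_divide_distrib mult_ac flip: power_mult)
  moreover have "(\<epsilon> ^ m) ^ n = 1"
  proof -
    have "\<epsilon> ^ n = cis (real n * (2 * pi / real n))"
      unfolding \<epsilon>_def by (rule Complex.DeMoivre)
    also have "real n * (2 * pi / real n) = 2 * pi"
      using n by simp
    finally have "\<epsilon> ^ n = 1"
      by simp
    then show ?thesis
      by (metis power_mult mult.commute power_one)
  qed
  ultimately show "fps_nth ?H m = (if n dvd m then fps_nth G m else 0)"
    using n by (simp add: sum_gp_strict pow)
qed

text \<open>The range condition says that \<open>g\<close> takes its values in the image of the unit disc under
  the Moebius map \<open>w \<mapsto> a w / (1 + b w)\<close>, whose inverse is \<open>y \<mapsto> y / (a - b y)\<close>. By convexity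
  the average \<open>h\<close> of \<open>g\<close> over rotations stays in this region. As \<open>h\<close> starts with the term of
  degree \<open>n\<close>, so does its preimage \<open>w\<close>, and the two leading coefficients differ by the
  factor \<open>a\<close>, the derivative of the Moebius map at 0.\<close>

lemma norm_coeff_le_of_norm_less_affine:
  fixes g :: "complex \<Rightarrow> complex" and a b :: real
  assumes hol: "g holomorphic_on ball 0 1" and g0: "g 0 = 0"
    and a: "a > 0" and b: "\<bar>b\<bar> \<le> 1"
    and range: "\<And>z. norm z < 1 \<Longrightarrow> norm (g z) < norm (of_real a - of_real b * g z)"
    and G: "g has_fps_expansion G" and n: "n \<ge> 1"
  shows "norm (fps_nth G n) \<le> a"
proof -
  define \<epsilon> where "\<epsilon> = cis (2 * pi / real n)"
  define h where "h z = (\<Sum>j<n. (1 / real n) *\<^sub>R g (\<epsilon> ^ j * z))" for z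
  obtain H where H: "h has_fps_expansion H"
    and H_nth: "\<And>m. fps_nth H m = (if n dvd m then fps_nth G m else 0)"
    using rotation_average_expansion[OF G n] unfolding h_def \<epsilon>_def by metis
  have norm_\<epsilon>: "norm (\<epsilon> ^ j * z) = norm z" for j z
    by (simp add: \<epsilon>_def norm_mult norm_power)
  have h_range: "norm (h z) < norm (of_real a - of_real b * h z)" if "norm z < 1" for z
  proof -
    have "h z \<in> {y. norm y < norm (of_real a - of_real b * y)}"
      unfolding h_def
      by (rule convex_sum[OF _ convex_norm_less_norm_affine[OF b]])
        (use n range that norm_\<epsilon> in auto)
    then show ?thesis by simp
  qed
  have h_hol: "h holomorphic_on ball 0 1"
    unfolding h_def scaleR_conv_of_real
  proof (intro holomorphic_intros)
    fix j
    have "g \<circ> (\<lambda>z. \<epsilon> ^ j * z) holomorphic_on ball 0 1"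
      by (rule holomorphic_on_compose_gen[OF _ hol])
        (use norm_\<epsilon> in \<open>auto intro!: holomorphic_intros\<close>)
    then show "(\<lambda>z. g (\<epsilon> ^ j * z)) holomorphic_on ball 0 1"
      by (simp add: o_def)
  qed
  define w where "w z = h z / (of_real a - of_real b * h z)" for z
  have den: "of_real a - of_real b * h z \<noteq> 0" if "norm z < 1" for z
    using h_range[OF that] by auto
  have w_hol: "w holomorphic_on ball 0 1"
    unfolding w_def using den by (intro holomorphic_intros h_hol) auto
  define W where "W = fps_expansion w 0"
  have W: "w has_fps_expansion W"
    unfolding W_def
    by (intro analytic_at_imp_has_fps_expansion_0 analytic_on_subset[OF holomorphic_on_imp_analytic_at[OF w_hol]])
      auto
  have W_bound: "norm (fps_nth W n) \<le> 1"
  proof (rule bounded_imp_norm_coeff_le[OF w_hol _ W])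
    fix z :: complex assume "norm z < 1"
    then show "norm (w z) \<le> 1"
      using h_range[of z] unfolding w_def norm_divide by (intro divide_le_eq_1[THEN iffD2]) auto
  qed
  define D where "D = fps_const (of_real a) - fps_const (of_real b) * H"
  have "(\<lambda>z. w z * (of_real a - of_real b * h z)) has_fps_expansion W * D"
    unfolding D_def by (intro fps_expansion_intros W H)
  moreover have "\<forall>\<^sub>F z in nhds 0. w z * (of_real a - of_real b * h z) = h z"
    by (rule eventually_nhds_0_of_ball[of 1]) (use den in \<open>auto simp: w_def\<close>)
  ultimately have "h has_fps_expansion W * D"
    using has_fps_expansion_cong[OF _ refl, of _ h] by metis
  then have HWD: "H = W * D"
    by (rule fps_expansion_unique_complex[OF H])
  have G_0: "fps_nth G 0 = 0"
    using has_fps_expansion_imp_0_eq_fps_nth_0[OF G] g0 by simp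
  have W_0: "fps_nth W 0 = 0"
  proof -
    have "h 0 = 0" by (simp add: h_def g0)
    then show ?thesis
      using has_fps_expansion_imp_0_eq_fps_nth_0[OF W] by (simp add: w_def)
  qed
  have D_0: "fps_nth D 0 = of_real a"
    by (simp add: D_def H_nth G_0)
  have D_mid: "fps_nth D k = 0" if "0 < k" "k < n" for k
    using that by (auto simp: D_def H_nth dest: dvd_imp_le)
  \<comment> \<open>Since \<open>D\<close> has no terms of degree strictly between 0 and \<open>n\<close>, and \<open>W\<close> no constant term,
     only \<open>i = n\<close> contributes to the Cauchy product.\<close>
  have "fps_nth G n = (\<Sum>i=0..n. fps_nth W i * fps_nth D (n - i))"
    using HWD H_nth[of n] by (simp add: fps_mult_nth)
  also have "\<dots> = (\<Sum>i\<in>{n}. fps_nth W i * fps_nth D (n - i))"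
  proof (rule sum.mono_neutral_right)
    show "\<forall>i\<in>{0..n} - {n}. fps_nth W i * fps_nth D (n - i) = 0"
    proof
      fix i assume "i \<in> {0..n} - {n}"
      then show "fps_nth W i * fps_nth D (n - i) = 0"
        using D_mid[of "n - i"] W_0 by (cases "i = 0") auto
    qed
  qed auto
  finally have "fps_nth G n = fps_nth W n * of_real a"
    by (simp add: D_0)
  then show ?thesis
    using W_bound a by (simp add: norm_mult mult_left_le_one_le)
qed

text \<open>Here \<open>g - 1 = (A - B) w / (1 + B w)\<close>, which is the preceding situation with \<open>a = A - B\<close>
  and \<open>b = B\<close>.\<close>

lemma subordinate_moebius_norm_coeff_le:
  fixes A B :: real
  assumes AB: "-1 \<le> B" "B < A" "A \<le> 1"
    and sub: "subordinate g (\<lambda>z. (1 + of_real A * z) / (1 + of_real B * z))"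
    and G: "g has_fps_expansion G" and n: "n \<ge> 1"
  shows "norm (fps_nth G n) \<le> A - B"
proof -
  from sub obtain w where g: "g analytic_on ball 0 1" and w0: "w 0 = 0"
    and w: "\<And>z. norm z < 1 \<Longrightarrow> norm (w z) < 1"
    and gw: "\<And>z. norm z < 1 \<Longrightarrow> g z = (1 + of_real A * w z) / (1 + of_real B * w z)"
    unfolding subordinate_def by auto
  have "norm (fps_nth (G - 1) n) \<le> A - B"
  proof (rule norm_coeff_le_of_norm_less_affine[where g = "\<lambda>z. g z - 1" and b = B])
    show "(\<lambda>z. g z - 1) holomorphic_on ball 0 1"
      by (intro holomorphic_intros analytic_imp_holomorphic[OF g])
    show "(\<lambda>z. g z - 1) has_fps_expansion G - 1"
      by (intro fps_expansion_intros G)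
    show "g 0 - 1 = 0" using gw[of 0] w0 by simp
    fix z :: complex assume z: "norm z < 1"
    have nz: "1 + of_real B * w z \<noteq> 0"
      using one_plus_mult_nonzero w[OF z] AB by simp
    have "g z - 1 = of_real (A - B) * w z / (1 + of_real B * w z)"
      unfolding gw[OF z] using nz by (simp add: field_simps)
    moreover from this have "of_real (A - B) - of_real B * (g z - 1)
        = of_real (A - B) / (1 + of_real B * w z)"
      using nz by (simp add: field_simps)
    ultimately show "norm (g z - 1) < norm (of_real (A - B) - of_real B * (g z - 1))"
      using w[OF z] AB nz by (simp add: norm_mult norm_divide divide_strict_right_mono del: of_real_diff)
  qed (use AB n in auto)
  then show ?thesis using n by simp
qed

section \<open>q-numbers\<close>

lemma q_num_strict_mono:
  assumes "0 < q" "q < 1" "x < y"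
  shows "q_num q x < q_num q y"
  using assms by (auto simp: q_num_def intro!: divide_strict_right_mono powr_less_mono')

lemma q_num_pos:
  assumes "0 < q" "q < 1" "x > 0"
  shows "q_num q x > 0"
  using q_num_strict_mono[OF assms] assms by (simp add: q_num_def)

lemma q_num_le_inverse:
  assumes "0 < q" "q < 1"
  shows "q_num q x \<le> 1 / (1 - q)"
  using assms by (simp add: q_num_def divide_right_mono)

lemma Lambda_pos:
  assumes q: "0 < q" "q < 1" and "\<mu> > -1"
  shows "Lambda q \<mu> m > 0"
  unfolding Lambda_def q_shifted_fact_def q_fact_def
  using assms by (intro divide_pos_pos prod_pos ballI q_num_pos) auto

text \<open>Each factor of the numerator is at most \<open>1 / (1 - q)\<close>, and each factor of the
  denominator at least \<open>[1,q] = 1\<close>. A geometric bound is enough to keep a positive radius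
  of convergence for the transformed series, and coefficients are compared only near 0.\<close>

lemma Lambda_le_power:
  assumes q: "0 < q" "q < 1" and mu: "\<mu> > -1"
  shows "Lambda q \<mu> m \<le> (1 / (1 - q)) ^ m"
proof -
  have "q_shifted_fact q (\<mu> + 1) m \<le> (\<Prod>k<m. 1 / (1 - q))"
    unfolding q_shifted_fact_def using mu
    by (intro prod_mono conjI q_num_le_inverse q less_imp_le[OF q_num_pos]) auto
  moreover have "q_fact q m \<ge> 1"
    unfolding q_fact_def
  proof (rule prod_ge_1)
    fix k assume "k \<in> {1..m}"
    then have "q_num q 1 \<le> q_num q (real k)"
      using q_num_strict_mono[OF q, of 1 "real k"] by (cases "k = 1") auto
    then show "1 \<le> q_num q (real k)" using q by (simp add: q_num_def)
  qed
  ultimately show ?thesis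
    unfolding Lambda_def using q
    by (subst pos_divide_le_eq) (auto intro: order_trans mult_left_mono[of 1 "q_fact q m", simplified])
qed

section \<open>Power series of the transformed function\<close>

definition normalized_fps :: "nat \<Rightarrow> (nat \<Rightarrow> complex) \<Rightarrow> complex fps" where
  "normalized_fps p a = Abs_fps (\<lambda>m. if m < p then 0 else if m = p then 1 else a m)"

lemma sums_normalized_fps_iff:
  "(\<lambda>n. fps_nth (normalized_fps p a) n * z ^ n) sums s
    \<longleftrightarrow> (\<lambda>n. a (Suc n + p) * z ^ (Suc n + p)) sums (s - z ^ p)"
proof -
  let ?c = "\<lambda>n. fps_nth (normalized_fps p a) n * z ^ n"
  have "(\<Sum>i<Suc p. ?c i) = z ^ p"
    by (simp add: normalized_fps_def)
  moreover have "?c (n + Suc p) = a (Suc n + p) * z ^ (Suc n + p)" for n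
    by (simp add: normalized_fps_def)
  ultimately show ?thesis
    using sums_iff_shift[of ?c "Suc p" "s - z ^ p"] by (simp only:) simp
qed

lemma has_expansion_imp_has_fps_expansion:
  assumes "has_expansion p a f"
  shows "f has_fps_expansion normalized_fps p a"
proof (rule has_fps_expansionI)
  show "\<forall>\<^sub>F u in nhds 0. (\<lambda>n. fps_nth (normalized_fps p a) n * u ^ n) sums f u"
    by (rule eventually_nhds_0_of_ball[of 1])
      (use assms in \<open>auto simp: has_expansion_def sums_normalized_fps_iff\<close>)
qed

lemma L_op_has_fps_expansion:
  assumes q: "0 < q" "q < 1" and mu: "\<mu> > -1" and f: "has_expansion p a f"
  shows "L_op q \<mu> p f has_fps_expansion normalized_fps p (\<lambda>m. of_real (Lambda q \<mu> m) * a m)"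
proof (rule has_fps_expansionI)
  let ?b = "\<lambda>m. of_real (Lambda q \<mu> m) * a m"
  have coeff: "taylor_coeff f (Suc n + p) = a (Suc n + p)" for n
    using fps_nth_fps_expansion[OF has_expansion_imp_has_fps_expansion[OF f], of "Suc n + p"]
    by (simp add: taylor_coeff_def normalized_fps_def)
  have "(\<lambda>n. fps_nth (normalized_fps p ?b) n * z ^ n) sums L_op q \<mu> p f z"
    if z: "z \<in> ball 0 (1 - q)" for z
  proof -
    \<comment> \<open>The bound on \<open>Lambda\<close> reduces the series at \<open>z\<close> to the original one at \<open>z / (1 - q)\<close>,
       which converges absolutely because this point lies inside the unit disc.\<close>
    define y where "y = z / of_real (1 - q)"
    have y: "norm y < 1"
      unfolding y_def norm_divide norm_of_real using z q by simp
    obtain x :: complex where x: "norm y < norm x" "norm x < 1"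
      using dense[OF y] by (metis norm_of_real abs_of_nonneg norm_ge_zero less_imp_le order_trans)
    have "summable (\<lambda>n. fps_nth (normalized_fps p a) n * x ^ n)"
      using f x unfolding has_expansion_def sums_normalized_fps_iff[symmetric]
      by (auto intro: sums_summable)
    from powser_insidea[OF this x(1)]
    have sm: "summable (\<lambda>n. norm (fps_nth (normalized_fps p a) (n + Suc p) * y ^ (n + Suc p)))"
      by (subst summable_iff_shift)
    have "summable (\<lambda>n. ?b (Suc n + p) * z ^ (Suc n + p))"
    proof (rule summable_comparison_test'[OF sm])
      fix n :: nat assume "n \<ge> 0"
      let ?m = "Suc n + p"
      have "norm (?b ?m * z ^ ?m) = Lambda q \<mu> ?m * (norm (a ?m) * norm z ^ ?m)"
        using Lambda_pos[OF q mu, of ?m] by (simp add: norm_mult norm_power mult_ac)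
      also have "\<dots> \<le> (1 / (1 - q)) ^ ?m * (norm (a ?m) * norm z ^ ?m)"
        by (intro mult_right_mono Lambda_le_power q mu) auto
      also have "\<dots> = norm (a ?m * y ^ ?m)"
        unfolding y_def norm_mult norm_power norm_divide norm_of_real
        using q by (simp add: power_divide)
      finally show "norm (?b ?m * z ^ ?m)
          \<le> norm (fps_nth (normalized_fps p a) (n + Suc p) * y ^ (n + Suc p))"
        by (simp add: normalized_fps_def)
    qed
    then show ?thesis
      unfolding sums_normalized_fps_iff L_op_def coeff by (simp add: summable_sums)
  qed
  then show "\<forall>\<^sub>F u in nhds 0.
      (\<lambda>n. fps_nth (normalized_fps p ?b) n * u ^ n) sums L_op q \<mu> p f u"
    by (intro eventually_nhds_0_of_ball[of "1 - q"]) (use q in auto)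
qed

text \<open>The equation is \<open>z \<partial>\<^sub>q F = [p,q] P F\<close> with the denominator \<open>1 - q\<close> cleared. The dilation
  \<open>F (q z)\<close> multiplies the coefficient of degree \<open>n + p\<close> by \<open>q\<^bsup>n+p\<^esup>\<close>, which produces
  \<open>(1 - q) [n+p,q]\<close> on the left; on the right the term with \<open>k = n\<close> of the Cauchy product is
  \<open>b (n + p)\<close> because \<open>P 0 = 1\<close>, and it is moved to the left.\<close>

lemma q_logarithmic_derivative_recursion:
  fixes F P :: "complex \<Rightarrow> complex" and q :: real
  assumes q: "0 < q" "q < 1" and p: "p \<ge> 1"
    and F: "F has_fps_expansion normalized_fps p b"
    and P: "P has_fps_expansion G" "fps_nth G 0 = 1"
    and eq: "\<And>z. z \<noteq> 0 \<Longrightarrow> norm z < 1 \<Longrightarrow> F z - F (of_real q * z)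
        = of_real ((1 - q) * q_num q (real p)) * (P z * F z)"
    and n: "n \<ge> 1"
  shows "of_real (q_num q (real (n + p)) - q_num q (real p)) * b (n + p)
    = of_real (q_num q (real p)) * (\<Sum>k<n. fps_nth G (n - k) * (if k = 0 then 1 else b (k + p)))"
proof -
  let ?FF = "normalized_fps p b" and ?K = "of_real ((1 - q) * q_num q (real p)) :: complex"
  have lin: "(\<lambda>z. of_real q * z :: complex) has_fps_expansion fps_const (of_real q) * fps_X"
    by (intro fps_expansion_intros)
  have "(\<lambda>z. F z - F (of_real q * z)) has_fps_expansion
      ?FF - (?FF oo (fps_const (of_real q) * fps_X))"
    using has_fps_expansion_diff[OF F has_fps_expansion_compose[OF F lin]] by (simp add: o_def)
  moreover have "(\<lambda>z. ?K * (P z * F z)) has_fps_expansion fps_const ?K * (G * ?FF)"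
    by (intro fps_expansion_intros P F)
  moreover have "\<forall>\<^sub>F z in nhds 0. F z - F (of_real q * z) = ?K * (P z * F z)"
  proof -
    have "F 0 = 0"
      using has_fps_expansion_imp_0_eq_fps_nth_0[OF F] p by (simp add: normalized_fps_def)
    then have "F z - F (of_real q * z) = ?K * (P z * F z)" if "norm z < 1" for z
      using that eq[of z] by (cases "z = 0") auto
    then show ?thesis
      by (intro eventually_nhds_0_of_ball[of 1]) auto
  qed
  ultimately have "?FF - (?FF oo (fps_const (of_real q) * fps_X)) = fps_const ?K * (G * ?FF)"
    using has_fps_expansion_cong[OF _ refl, of _ "\<lambda>z. ?K * (P z * F z)"]
      fps_expansion_unique_complex by metis
  then have "fps_nth (?FF - (?FF oo (fps_const (of_real q) * fps_X))) (n + p)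
      = fps_nth (fps_const ?K * (G * ?FF)) (n + p)"
    by simp
  moreover have "fps_nth (?FF - (?FF oo (fps_const (of_real q) * fps_X))) (n + p)
      = of_real (1 - q) * (of_real (q_num q (real (n + p))) * b (n + p))"
  proof -
    have "of_real (1 - q) * of_real (q_num q (real (n + p))) = (1 - of_real q ^ (n + p) :: complex)"
      unfolding of_real_mult[symmetric] using q
      by (simp add: q_num_def powr_realpow del: of_nat_add)
    moreover have "fps_nth ?FF (n + p) = b (n + p)"
      using n by (simp add: normalized_fps_def)
    ultimately show ?thesis
      by (simp only: fps_compose_linear fps_sub_nth fps_nth_Abs_fps mult.assoc[symmetric]
          left_diff_distrib mult_1)
  qed
  moreover have "fps_nth (G * ?FF) (n + p)
      = b (n + p) + (\<Sum>k<n. fps_nth G (n - k) * (if k = 0 then 1 else b (k + p)))"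
  proof -
    have "fps_nth (G * ?FF) (n + p) = (\<Sum>i=0..n + p. fps_nth ?FF i * fps_nth G (n + p - i))"
      by (simp add: mult.commute[of G] fps_mult_nth)
    also have "\<dots> = (\<Sum>i=0 + p..n + p. fps_nth ?FF i * fps_nth G (n + p - i))"
      by (rule sum.mono_neutral_right) (auto simp: normalized_fps_def)
    also have "\<dots> = (\<Sum>k=0..n. fps_nth ?FF (k + p) * fps_nth G (n - k))"
      by (subst sum.shift_bounds_cl_nat_ivl) simp
    also have "{0..n} = insert n {..<n}" by auto
    finally show ?thesis
      using n P(2) by (simp add: normalized_fps_def mult.commute cong: sum.cong)
  qed
  ultimately have "of_real (1 - q) * (of_real (q_num q (real (n + p))) * b (n + p))
      = of_real (1 - q) * (of_real (q_num q (real p)) *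
        (b (n + p) + (\<Sum>k<n. fps_nth G (n - k) * (if k = 0 then 1 else b (k + p)))))"
    by (simp only: fps_mult_left_const_nth of_real_mult mult.assoc)
  moreover have nz: "of_real (1 - q) \<noteq> (0 :: complex)"
    using q by (simp del: of_real_diff)
  ultimately have "of_real (q_num q (real (n + p))) * b (n + p) = of_real (q_num q (real p)) *
      (b (n + p) + (\<Sum>k<n. fps_nth G (n - k) * (if k = 0 then 1 else b (k + p))))"
    by (simp only: mult_left_cancel[OF nz])
  then show ?thesis
    by (simp add: algebra_simps)
qed

section \<open>The coefficient estimate\<close>

text \<open>A discrete Gronwall inequality: adding \<open>x n\<close> to the partial sum multiplies its bound by at
  most \<open>1 + K n\<close>.\<close>

lemma sum_le_prod_of_recursive_bound:
  fixes x K :: "nat \<Rightarrow> real"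
  assumes x0: "x 0 = 1" and K: "\<And>n. n \<ge> 1 \<Longrightarrow> K n \<ge> 0"
    and rec: "\<And>n. n \<ge> 1 \<Longrightarrow> x n \<le> K n * (\<Sum>k<n. x k)"
    and n: "n \<ge> 1"
  shows "(\<Sum>k<n. x k) \<le> (\<Prod>t=1..n-1. 1 + K t)"
  using n
proof (induction n rule: dec_induct)
  case base
  then show ?case using x0 by simp
next
  case (step n)
  have "(\<Sum>k<Suc n. x k) \<le> (1 + K n) * (\<Sum>k<n. x k)"
    using rec[OF step.hyps(1)] by (simp add: algebra_simps)
  also have "\<dots> \<le> (1 + K n) * (\<Prod>t=1..n-1. 1 + K t)"
    using step.IH K[OF step.hyps(1)] by (intro mult_left_mono) auto
  also have "\<dots> = (\<Prod>t=1..Suc n-1. 1 + K t)"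
    using step.hyps(1) by (cases n) (simp_all add: mult.commute)
  finally show ?case .
qed

text \<open>Division by zero gives zero, so the definition of the quotient can be multiplied out only
  where \<open>L_op q \<mu> p f z \<noteq> 0\<close>. This holds on the punctured disc since the quotient is a value
  \<open>(1 + A w) / (1 + B w)\<close> with \<open>norm w < 1\<close>, and such a value is not 0.\<close>

lemma class_S_functional_equation:
  assumes q: "0 < q" "q < 1" and p: "p \<ge> 1" and AB: "-1 \<le> B" "B < A" "A \<le> 1"
    and f: "f \<in> class_S p q \<mu> A B" and z: "z \<noteq> 0" "norm z < 1"
  shows "L_op q \<mu> p f z - L_op q \<mu> p f (of_real q * z)
    = of_real ((1 - q) * q_num q (real p)) * (L_quotient q \<mu> p f z * L_op q \<mu> p f z)"
proof -
  from f obtain w where w: "\<forall>z\<in>ball 0 1. norm (w z) < 1 \<and>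
      L_quotient q \<mu> p f z = (1 + of_real A * w z) / (1 + of_real B * w z)"
    unfolding class_S_def subordinate_def by blast
  have "norm (w z) < 1"
    and "L_quotient q \<mu> p f z = (1 + of_real A * w z) / (1 + of_real B * w z)"
    using w z by auto
  then have "L_quotient q \<mu> p f z \<noteq> 0"
    using one_plus_mult_nonzero[of A "w z"] one_plus_mult_nonzero[of B "w z"] AB by auto
  then have "L_op q \<mu> p f z \<noteq> 0"
    using z by (auto simp: L_quotient_def)
  moreover have "q_num q (real p) \<noteq> 0"
    using q_num_pos[OF q, of "real p"] p by simp
  moreover have "(1 - of_real q :: complex) \<noteq> 0"
    using q by (metis eq_iff_diff_eq_0 less_irrefl of_real_eq_1_iff)
  ultimately show ?thesis
    using z by (simp add: L_quotient_def q_deriv_def)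
qed

lemma class_S_norm_coeff_le:
  assumes p: "p \<ge> 1" and q: "0 < q" "q < 1" and mu: "\<mu> > -1"
    and AB: "-1 \<le> B" "B < A" "A \<le> 1"
    and f: "f \<in> class_S p q \<mu> A B" and a: "has_expansion p a f"
    and n: "n \<ge> 1"
  shows "norm (a (n + p)) \<le> (A - B) * psi p q n / Lambda q \<mu> (n + p) *
    (\<Prod>t=1..n-1. 1 + (A - B) * psi p q t)"
proof -
  define P where "P = L_quotient q \<mu> p f"
  define G where "G = fps_expansion P 0"
  define b where "b m = of_real (Lambda q \<mu> m) * a m" for m
  define x where "x k = norm (if k = 0 then 1 else b (k + p))" for k
  have sub: "subordinate P (\<lambda>z. (1 + of_real A * z) / (1 + of_real B * z))"
    using f by (simp add: class_S_def P_def)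
  have "P analytic_on ball 0 1"
    using sub by (simp add: subordinate_def)
  then have "P analytic_on {0}"
    by (rule analytic_on_subset) auto
  then have G: "P has_fps_expansion G"
    unfolding G_def by (rule analytic_at_imp_has_fps_expansion_0)
  have G_0: "fps_nth G 0 = 1"
    using has_fps_expansion_imp_0_eq_fps_nth_0[OF G] by (simp add: P_def L_quotient_def)
  have F: "L_op q \<mu> p f has_fps_expansion normalized_fps p b"
    using L_op_has_fps_expansion[OF q mu a] unfolding b_def .
  have psi_pos: "psi p q m > 0" and gap: "q_num q (real (m + p)) - q_num q (real p) > 0"
    if "m \<ge> 1" for m
    using q_num_pos[OF q, of "real p"] q_num_strict_mono[OF q, of "real p" "real (m + p)"]
      p that by (auto simp: psi_def)
  have rec: "x m \<le> (A - B) * psi p q m * (\<Sum>k<m. x k)" if m: "m \<ge> 1" for m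
  proof -
    let ?g = "q_num q (real (m + p)) - q_num q (real p)"
    have pos: "q_num q (real p) \<ge> 0"
      using q_num_pos[OF q, of "real p"] p by simp
    have "of_real ?g * b (m + p) = of_real (q_num q (real p)) *
        (\<Sum>k<m. fps_nth G (m - k) * (if k = 0 then 1 else b (k + p)))"
      by (rule q_logarithmic_derivative_recursion[OF q p F G G_0 _ m])
        (use class_S_functional_equation[OF q p AB f] in \<open>simp add: P_def\<close>)
    from arg_cong[OF this, of norm]
    have "?g * x m = q_num q (real p) *
        norm (\<Sum>k<m. fps_nth G (m - k) * (if k = 0 then 1 else b (k + p)))"
      using gap[OF m] m pos unfolding norm_mult norm_of_real x_def by simp
    also have "\<dots> \<le> q_num q (real p) * (\<Sum>k<m. (A - B) * x k)"
    proof (intro mult_left_mono sum_norm_le pos)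
      fix k assume "k \<in> {..<m}"
      then show "norm (fps_nth G (m - k) * (if k = 0 then 1 else b (k + p))) \<le> (A - B) * x k"
        unfolding norm_mult x_def
        by (intro mult_right_mono subordinate_moebius_norm_coeff_le[OF AB sub G]) auto
    qed
    also have "\<dots> = q_num q (real p) * ((A - B) * (\<Sum>k<m. x k))"
      by (simp add: sum_distrib_left)
    finally show ?thesis
      using gap[OF m] by (simp add: psi_def pos_le_divide_eq mult_ac)
  qed
  have K: "(A - B) * psi p q m \<ge> 0" if "m \<ge> 1" for m
    using psi_pos[OF that] AB by simp
  have "x n \<le> (A - B) * psi p q n * (\<Sum>k<n. x k)"
    by (rule rec[OF n])
  also have "\<dots> \<le> (A - B) * psi p q n * (\<Prod>t=1..n-1. 1 + (A - B) * psi p q t)"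
    by (intro mult_left_mono K n sum_le_prod_of_recursive_bound rec) (auto simp: x_def)
  finally show ?thesis
    using Lambda_pos[OF q mu, of "n + p"] n
    by (simp add: x_def b_def norm_mult field_simps)
qed

theorem theorem3p3:
  fixes p :: nat and q \<mu> A B :: real
    and f :: "complex \<Rightarrow> complex" and a :: "nat \<Rightarrow> complex"
  assumes "p \<ge> 1"
    and "0 < q" and "q < 1"
    and "\<mu> > -1"
    and "-1 \<le> B" and "B < A" and "A \<le> 1"
    and "f \<in> class_S p q \<mu> A B"
    and "has_expansion p a f"
  shows "norm (a (p + 1)) \<le> psi p q 1 * (A - B) / Lambda q \<mu> (1 + p) \<and>
    (\<forall>n\<ge>2. norm (a (n + p)) \<le>
       (A - B) * psi p q n / Lambda q \<mu> (n + p) *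
       (\<Prod>t=1..n-1. 1 + q_num q (real p) * (A - B) /
          (q_num q (real (p + t)) - q_num q (real p))))"
proof -
  note bound = class_S_norm_coeff_le[OF assms]
  have "(A - B) * psi p q t = q_num q (real p) * (A - B) /
      (q_num q (real (p + t)) - q_num q (real p))" for t
    by (simp add: psi_def add.commute mult.commute)
  then show ?thesis
    using bound[of 1] bound by (simp add: mult.commute add.commute)
qed

end
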